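(* Let $f\in\mathcal{F}_d$ be the pmf of a $d$-dimensional multivariate Bernoulli random variable $X=(X_1,\ldots,X_d)$ and let $p_S$ be the pmf of the sum $S=\sum_{i=1}^dX_i$, with $p_S(k)=p_k=P(S=k)$, $k=0,\ldots,d$. The sum of the second-order crossed moments of $X$ can be written as a linear combination of the values $p_k$, $k=2,\ldots,d$: $$\sum_{1\le i<j\le d}E[X_iX_j]=\sum_{k=2}^d\binom{k}{2}p_k.$$
   Context: $\mathcal{F}_d$ is the set of $d$-dimensional probability mass functions (pmfs) on $\{0,1\}^d$, i.e. those whose univariate marginals are all Bernoulli distributions. *)

theory Defs
  imports "HOL-Probability.Probability"
begin

text \<open>
  Vectors in \<open>{0,1}^d\<close> are extensional functions on the index set \<open>{1..d}\<close>, with real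
  entries so that products and sums of coordinates can be integrated directly.
\<close>

definition bernoulli_cube :: "nat \<Rightarrow> (nat \<Rightarrow> real) set" where
  "bernoulli_cube d = {1..d} \<rightarrow>\<^sub>E {0, 1}"

definition bernoulli_pmfs :: "nat \<Rightarrow> (nat \<Rightarrow> real) pmf set" where
  "bernoulli_pmfs d = {f. set_pmf f \<subseteq> bernoulli_cube d}"

text \<open>
  If \<open>f\<close> is concentrated on \<open>{0,1}^d\<close>, the condition below forces the random vector to take
  values in \<open>{0,1}^d\<close> almost surely, but not necessarily everywhere.
\<close>

definition has_joint_pmf ::
  "'a measure \<Rightarrow> nat \<Rightarrow> (nat \<Rightarrow> 'a \<Rightarrow> real) \<Rightarrow> (nat \<Rightarrow> real) pmf \<Rightarrow> bool" where
  "has_joint_pmf M d X f \<longleftrightarrow>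
     (\<forall>i\<in>{1..d}. X i \<in> borel_measurable M) \<and>
     (\<forall>x\<in>extensional {1..d}. \<P>(\<omega> in M. \<forall>i\<in>{1..d}. X i \<omega> = x i) = pmf f x)"

end

theory Submission
  imports Defs
begin

text \<open>
  The joint law puts mass one on the finite set \<open>{0,1}^d\<close>, so almost surely exactly \<open>k\<close> of the
  coordinates equal one for some \<open>k \<le> d\<close>. On that event \<open>S = k\<close>, and the products
  \<open>X\<^sub>i X\<^sub>j\<close> that equal one are indexed by the two-element subsets of those coordinates. The
  identity thus holds pointwise almost surely, and it remains to take expectations.
\<close>

lemma finite_ordered_pairs: "finite {(i, j). 1 \<le> i \<and> i < j \<and> j \<le> (d::nat)}"
  by (rule finite_subset[of _ "{1..d} \<times> {1..d}"]) auto

text \<open>The pairs gained in passing from \<open>d\<close> to \<open>Suc d\<close> are exactly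
  those with larger entry \<open>Suc d\<close>. This recursion drives the induction in
  \<open>zero_one_pair_sum\<close>.\<close>

lemma sum_ordered_pairs_Suc:
  fixes g :: "nat \<Rightarrow> nat \<Rightarrow> 'b::comm_monoid_add"
  shows "(\<Sum>(i, j)\<in>{(i, j). 1 \<le> i \<and> i < j \<and> j \<le> Suc d}. g i j)
       = (\<Sum>(i, j)\<in>{(i, j). 1 \<le> i \<and> i < j \<and> j \<le> d}. g i j) + (\<Sum>i=1..d. g i (Suc d))"
proof -
  let ?P = "\<lambda>d. {(i, j). 1 \<le> i \<and> i < j \<and> j \<le> (d::nat)}"
  let ?Q = "(\<lambda>i. (i, Suc d)) ` {1..d}"
  have "?P (Suc d) = ?P d \<union> ?Q"
    by (auto simp: image_iff le_Suc_eq)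
  moreover have "?P d \<inter> ?Q = {}"
    by auto
  moreover have "sum (\<lambda>(i, j). g i j) ?Q = (\<Sum>i=1..d. g i (Suc d))"
    by (simp add: sum.reindex inj_on_def)
  ultimately show ?thesis
    using sum.union_disjoint[of "?P d" ?Q "\<lambda>(i, j). g i j"] finite_ordered_pairs[of d] by simp
qed

text \<open>The witness \<open>k\<close> counts the ones among the coordinates. By induction: a
  further coordinate equal to one forms a nonzero product with each of the \<open>k\<close> earlier
  ones, so the pair sum grows by \<open>k\<close>, in accordance with Pascal's rule.\<close>

lemma zero_one_pair_sum:
  fixes y :: "nat \<Rightarrow> real"
  assumes "\<And>i. i \<in> {1..d} \<Longrightarrow> y i \<in> {0, 1}"
  shows "\<exists>k\<le>d. (\<Sum>i=1..d. y i) = real k \<and>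
    (\<Sum>(i, j)\<in>{(i, j). 1 \<le> i \<and> i < j \<and> j \<le> d}. y i * y j) = real (k choose 2)"
  using assms
proof (induction d)
  case 0
  have empty: "{(i, j). 1 \<le> i \<and> i < j \<and> j \<le> (0::nat)} = {}"
    by auto
  show ?case
    unfolding empty by simp
next
  case (Suc d)
  then obtain k where k: "k \<le> d" "(\<Sum>i=1..d. y i) = real k"
    "(\<Sum>(i, j)\<in>{(i, j). 1 \<le> i \<and> i < j \<and> j \<le> d}. y i * y j) = real (k choose 2)"
    by fastforce
  have pairs: "(\<Sum>(i, j)\<in>{(i, j). 1 \<le> i \<and> i < j \<and> j \<le> Suc d}. y i * y j)
      = real (k choose 2) + real k * y (Suc d)"
    by (simp only: sum_ordered_pairs_Suc k sum_distrib_right[symmetric])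
  have "y (Suc d) = 0 \<or> y (Suc d) = 1"
    using Suc.prems[of "Suc d"] by simp
  then show ?case
  proof
    assume "y (Suc d) = 0"
    then show ?thesis
      using k pairs by (intro exI[of _ k]) simp
  next
    assume "y (Suc d) = 1"
    then show ?thesis
      \<comment> \<open>Rewriting 2 as \<open>Suc (Suc 0)\<close> lets the recursion for binomial
        coefficients expand \<open>Suc k choose 2\<close> to
        \<open>k + (k choose 2)\<close>.\<close>
      using k pairs by (intro exI[of _ "Suc k"]) (simp add: numeral_2_eq_2)
  qed
qed

text \<open>The events \<open>E x\<close>, for \<open>x\<close> in the cube, are disjoint and finite
  in number, so the probability of their union is the total mass that \<open>f\<close> puts on the
  cube.\<close>

lemma AE_in_bernoulli_cube:
  assumes "prob_space M" and f: "f \<in> bernoulli_pmfs d" and X: "has_joint_pmf M d X f"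
  shows "AE \<omega> in M. \<forall>i\<in>{1..d}. X i \<omega> \<in> {0, 1}"
proof -
  interpret prob_space M by fact
  define E where "E x = {\<omega> \<in> space M. \<forall>i\<in>{1..d}. X i \<omega> = x i}" for x
  have fin: "finite (bernoulli_cube d)"
    by (simp add: bernoulli_cube_def finite_PiE)
  have [measurable]: "X i \<in> borel_measurable M" if "i \<in> {1..d}" for i
    using X that by (simp add: has_joint_pmf_def)
  have sets: "E x \<in> sets M" for x
    unfolding E_def by (intro sets.sets_Collect_finite_All) auto
  have "disjoint_family_on E (bernoulli_cube d)"
  proof (unfold disjoint_family_on_def, intro ballI impI)
    fix x y assume xy: "x \<in> bernoulli_cube d" "y \<in> bernoulli_cube d" "x \<noteq> y"
    \<comment> \<open>Points of the cube are extensional, hence determined by their values on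
      \<open>{1..d}\<close>.\<close>
    then have "\<exists>i\<in>{1..d}. x i \<noteq> y i"
      unfolding bernoulli_cube_def by (meson PiE_ext)
    then show "E x \<inter> E y = {}"
      by (force simp: E_def)
  qed
  then have "prob (\<Union>x\<in>bernoulli_cube d. E x) = (\<Sum>x\<in>bernoulli_cube d. prob (E x))"
    using fin sets by (intro finite_measure_finite_Union) auto
  also have "\<dots> = (\<Sum>x\<in>bernoulli_cube d. pmf f x)"
    using X by (intro sum.cong) (auto simp: has_joint_pmf_def E_def bernoulli_cube_def PiE_def)
  also have "\<dots> = 1"
    using f fin by (intro sum_pmf_eq_1) (auto simp: bernoulli_pmfs_def)
  finally have "AE \<omega> in M. \<omega> \<in> (\<Union>x\<in>bernoulli_cube d. E x)"
    using fin sets by (subst prob_eq_1[symmetric]) auto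
  then show ?thesis
    by eventually_elim (auto simp: E_def bernoulli_cube_def PiE_iff)
qed

theorem proposition5p4:
  fixes M :: "'a measure" and d :: nat and X :: "nat \<Rightarrow> 'a \<Rightarrow> real"
    and f :: "(nat \<Rightarrow> real) pmf" and S :: "'a \<Rightarrow> real" and p :: "nat \<Rightarrow> real"
  assumes "prob_space M"
    and "f \<in> bernoulli_pmfs d"
    and "has_joint_pmf M d X f"
    and "\<And>\<omega>. S \<omega> = (\<Sum>i=1..d. X i \<omega>)"
    and "\<And>k. k \<le> d \<Longrightarrow> p k = \<P>(\<omega> in M. S \<omega> = real k)"
  shows "(\<Sum>(i, j)\<in>{(i, j). 1 \<le> i \<and> i < j \<and> j \<le> d}.
            prob_space.expectation M (\<lambda>\<omega>. X i \<omega> * X j \<omega>))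
       = (\<Sum>k=2..d. real (k choose 2) * p k)"
proof -
  interpret prob_space M by fact
  let ?P = "{(i, j). 1 \<le> i \<and> i < j \<and> j \<le> d}"
  have meas [measurable]: "X i \<in> borel_measurable M" if "i \<in> {1..d}" for i
    using assms(3) that by (simp add: has_joint_pmf_def)
  have S [measurable]: "S \<in> borel_measurable M"
    unfolding assms(4)[abs_def] by measurable
  have AE01: "AE \<omega> in M. \<forall>i\<in>{1..d}. X i \<omega> \<in> {0, 1}"
    by (rule AE_in_bernoulli_cube) fact+
  \<comment> \<open>Almost sure boundedness by 1 suffices because the measure is finite.
    Integrability is what allows expectation and finite sum to be exchanged below.\<close>
  have int: "integrable M (\<lambda>\<omega>. X i \<omega> * X j \<omega>)" if "(i, j) \<in> ?P" for i j
  proof (rule integrable_const_bound[of _ 1])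
    have ij: "i \<in> {1..d}" "j \<in> {1..d}"
      using that by auto
    show "AE \<omega> in M. norm (X i \<omega> * X j \<omega>) \<le> 1"
      using AE01
    proof eventually_elim
      case (elim \<omega>)
      show ?case
        using elim[rule_format, OF ij(1)] elim[rule_format, OF ij(2)] by auto
    qed
    show "(\<lambda>\<omega>. X i \<omega> * X j \<omega>) \<in> borel_measurable M"
      using ij[THEN meas] by measurable
  qed
  have eq: "AE \<omega> in M. (\<Sum>(i, j)\<in>?P. X i \<omega> * X j \<omega>)
      = (\<Sum>k=2..d. real (k choose 2) * indicator {\<omega>\<in>space M. S \<omega> = real k} \<omega>)"
    \<comment> \<open>\<open>AE_space\<close> provides \<omega> in \<open>space M\<close>, without
      which the indicator of the event \<open>S = k\<close> would vanish.\<close>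
    using AE01 AE_space
  proof eventually_elim
    case (elim \<omega>)
    obtain k where k: "k \<le> d" "S \<omega> = real k" "(\<Sum>(i, j)\<in>?P. X i \<omega> * X j \<omega>) = real (k choose 2)"
      using zero_one_pair_sum[of d "\<lambda>i. X i \<omega>", OF elim(1)[rule_format]] unfolding assms(4) by blast
    have "(\<Sum>l=2..d. real (l choose 2) * indicator {\<omega>\<in>space M. S \<omega> = real l} \<omega>)
        = (\<Sum>l=2..d. if k = l then real (l choose 2) else (0::real))"
      using elim(2) k(2) by (intro sum.cong) auto
    \<comment> \<open>If \<open>k < 2\<close>, no index in the range matches and the sum is 0, but
      then \<open>k choose 2\<close> is 0 as well.\<close>
    also have "\<dots> = real (k choose 2)"
      using k(1) by (simp add: not_le)
    finally show ?case
      using k(3) by simp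
  qed
  have "(\<Sum>(i, j)\<in>?P. expectation (\<lambda>\<omega>. X i \<omega> * X j \<omega>))
      = expectation (\<lambda>\<omega>. \<Sum>(i, j)\<in>?P. X i \<omega> * X j \<omega>)"
    using int by (subst Bochner_Integration.integral_sum) (auto simp: case_prod_beta)
  also have "\<dots> = expectation
      (\<lambda>\<omega>. \<Sum>k=2..d. real (k choose 2) * indicator {\<omega>\<in>space M. S \<omega> = real k} \<omega>)"
  proof (rule integral_cong_AE)
    show "(\<lambda>\<omega>. \<Sum>(i, j)\<in>?P. X i \<omega> * X j \<omega>) \<in> borel_measurable M"
      using int by (intro borel_measurable_sum) (auto dest: borel_measurable_integrable)
  qed (use eq in measurable)
  also have "\<dots> = (\<Sum>k=2..d. real (k choose 2) * prob {\<omega>\<in>space M. S \<omega> = real k})"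
  proof -
    have "{\<omega>\<in>space M. S \<omega> = real k} \<in> events" for k
      by measurable
    then show ?thesis
      by (subst Bochner_Integration.integral_sum)
        (auto intro!: integrable_real_indicator simp: emeasure_eq_measure)
  qed
  also have "\<dots> = (\<Sum>k=2..d. real (k choose 2) * p k)"
    using assms(5) by (intro sum.cong) auto
  finally show ?thesis .
qed

end
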